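(* Let $n\geq 2$. Every $8$-cycle in $BP_n$, written in canonical form as a sequence of prefix reversal labels, is one of the following: (1) $r_{k}r_{j}r_{i}r_{j}r_{k}r_{k-j+i}r_{i}r_{k-j+i}$, for $1\leq i<j\leq k-1$ and $3\leq k\leq n$; (2) $r_{k}r_{j}r_{k}r_{i}r_{k}r_{j}r_{k}r_{i}$, for $2\leq i,j\leq k-2$, $i+j\leq k$, and $4\leq k\leq n$; (3) $r_{k}r_{i}r_{k}r_{1}r_{k}r_{i}r_{k}r_{1}$, for $2\leq i\leq k-1$ and $3\leq k\leq n$; (4) $r_{k}r_{1}r_{k}r_{1}r_{k}r_{1}r_{k}r_{1}$, for $2\leq k\leq n$.
   Context: A signed permutation of $[\pm n]$ is a bijection $w$ of $[\pm n]=\{-n,\dots,-1,1,\dots,n\}$ with $w(-i)=-w(i)$, written in window notation $w=[w(1)\cdots w(n)]$, with $\underline{i}=-i$; $B_n$ denotes the group of signed permutations. For $1\leq i\leq n$, $w r_i=[\underline{w(i)}\cdots\underline{w(1)}\,w(i+1)\cdots w(n)]$. The burnt pancake graph $BP_n$ has vertex set $B_n$ and an edge $\{w,wr_i\}$ labeled $r_i$ for each $w\in B_n$, $1\leq i\leq n$. A cycle $w, wr_{i_1}, wr_{i_1}r_{i_2},\dots, wr_{i_1}\cdots r_{i_m}=w$ is denoted by its label sequence $r_{i_1}r_{i_2}\cdots r_{i_m}$; a cycle is in canonical form if its index sequence $i_1,i_2,\dots,i_m$ is lexicographically maximal among the label sequences representing that cycle (over all choices of starting vertex and direction of traversal). 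*)

theory Defs
  imports "HOL-Combinatorics.Combinatorics" "HOL-Library.List_Lexorder"
begin

definition pm_set :: "nat \<Rightarrow> int set"
  where "pm_set n = {- int n..-1} \<union> {1..int n}"

text \<open>Signed permutations are functions on all integers that are the identity outside
  \<^term>\<open>pm_set n\<close> (the convention of \<^const>\<open>permutes\<close>), so that equality of functions
  is equality of signed permutations and the group product is composition.\<close>

definition signed_perms :: "nat \<Rightarrow> (int \<Rightarrow> int) set"
  where "signed_perms n = {w. w permutes pm_set n \<and> (\<forall>x\<in>pm_set n. w (- x) = - w x)}"

definition window :: "nat \<Rightarrow> (int \<Rightarrow> int) \<Rightarrow> int list"
  where "window n w = map w [1..int n]"

text \<open>The reversal \<open>r\<^sub>i\<close> as a signed permutation, with window
  \<open>[-i, ..., -1, i+1, ..., n]\<close>. It acts on vertices by right multiplication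
  \<open>w r\<^sub>i = w \<circ> r\<^sub>i\<close>; see \<open>window_prefix_reversal\<close> below.\<close>

definition prefix_reversal :: "nat \<Rightarrow> int \<Rightarrow> int"
  where "prefix_reversal i x =
    (if 1 \<le> x \<and> x \<le> int i then x - (int i + 1)
     else if - int i \<le> x \<and> x \<le> -1 then x + (int i + 1)
     else x)"

lemma prefix_reversal_in_signed_perms:
  assumes "i \<le> n"
  shows "prefix_reversal i \<in> signed_perms n"
proof -
  have inv: "prefix_reversal i (prefix_reversal i x) = x" for x
    by (auto simp: prefix_reversal_def)
  have "prefix_reversal i x = x" if "x \<notin> pm_set n" for x
    using that assms by (auto simp: prefix_reversal_def pm_set_def)
  then have "prefix_reversal i permutes pm_set n"
    unfolding permutes_def by (metis inv)
  then show ?thesis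
    by (auto simp: signed_perms_def prefix_reversal_def pm_set_def)
qed

lemma window_prefix_reversal:
  assumes w: "w \<in> signed_perms n" and i: "i \<le> n"
  shows "window n (w \<circ> prefix_reversal i)
       = map uminus (rev (take i (window n w))) @ drop i (window n w)"
proof (rule nth_equalityI)
  show "length (window n (w \<circ> prefix_reversal i))
      = length (map uminus (rev (take i (window n w))) @ drop i (window n w))"
    using i by (simp add: window_def)
next
  fix m assume "m < length (window n (w \<circ> prefix_reversal i))"
  then have m: "m < n" by (simp add: window_def)
  show "window n (w \<circ> prefix_reversal i) ! m
      = (map uminus (rev (take i (window n w))) @ drop i (window n w)) ! m"
  proof (cases "m < i")
    case True
    then have "int i - int m \<in> pm_set n" using i by (auto simp: pm_set_def)
    then have "w (- (int i - int m)) = - w (int i - int m)"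
      using w unfolding signed_perms_def by blast
    moreover have "int (i - Suc m) = int i - 1 - int m" using True by simp
    ultimately show ?thesis using True m i
      by (simp add: window_def prefix_reversal_def nth_append rev_nth min_absorb2)
  next
    case False
    then show ?thesis using m i
      by (simp add: window_def prefix_reversal_def nth_append min_absorb2)
  qed
qed

definition burnt_pancake_verts :: "nat \<Rightarrow> (int \<Rightarrow> int) set"
  where "burnt_pancake_verts n = signed_perms n"

definition burnt_pancake_edges :: "nat \<Rightarrow> (int \<Rightarrow> int) set set"
  where "burnt_pancake_edges n =
    {{w, w \<circ> prefix_reversal i} | w i. w \<in> burnt_pancake_verts n \<and> 1 \<le> i \<and> i \<le> n}"

text \<open>A cycle of length \<open>m\<close> is given by the list \<open>[v\<^sub>0, ..., v\<^sub>m\<^sub>-\<^sub>1]\<close> of its distinct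
  vertices in order of traversal; the starting vertex is not repeated at the end.\<close>

definition burnt_pancake_cycle :: "nat \<Rightarrow> (int \<Rightarrow> int) list \<Rightarrow> bool"
  where "burnt_pancake_cycle n vs \<longleftrightarrow>
    3 \<le> length vs \<and> distinct vs \<and> set vs \<subseteq> burnt_pancake_verts n \<and>
    (\<forall>t<length vs. {vs ! t, vs ! (Suc t mod length vs)} \<in> burnt_pancake_edges n)"

definition traversals :: "'a list \<Rightarrow> 'a list set"
  where "traversals vs = {rotate s vs | s. True} \<union> {rotate s (rev vs) | s. True}"

definition label_sequence :: "nat \<Rightarrow> (int \<Rightarrow> int) list \<Rightarrow> nat list \<Rightarrow> bool"
  where "label_sequence n vs ls \<longleftrightarrow>
    length ls = length vs \<and>
    (\<forall>t<length vs. 1 \<le> ls ! t \<and> ls ! t \<le> n \<and>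
       vs ! (Suc t mod length vs) = vs ! t \<circ> prefix_reversal (ls ! t))"

text \<open>\<^const>\<open>Max\<close> refers to the lexicographic order on \<^typ>\<open>nat list\<close>.\<close>

definition canonical_form :: "nat \<Rightarrow> (int \<Rightarrow> int) list \<Rightarrow> nat list"
  where "canonical_form n vs = Max {ls. \<exists>us\<in>traversals vs. label_sequence n us ls}"

end

theory Submission
  imports Defs
begin

text \<open>The largest label \<open>k\<close> of a relation \<open>r\<^sub>i\<^sub>1 \<cdots> r\<^sub>i\<^sub>8 = 1\<close> comes first in the canonical form.
  Cut the word at the occurrences of \<open>k\<close>. All other labels fix position \<open>k\<close>, whereas \<open>r\<^sub>k\<close>
  exchanges \<open>k\<close> and \<open>-1\<close>; following \<open>k\<close> through the word therefore gives, for each choice of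
  starting point, an equation for the images of \<open>1\<close> under the pieces. One occurrence is impossible;
  for two occurrences both pieces fix \<open>1\<close>, hence have the form \<open>r\<^sub>z r\<^sub>y r\<^sub>z\<close>; for three the
  equations contradict each other; for four the relation says that flipping some top and some bottom
  of a stack of \<open>k\<close> pancakes commutes, which forces top and bottom to be disjoint.\<close>

section \<open>Words in the reversals as maps on the integers\<close>

text \<open>The last label acts on an integer first: a walk multiplies vertices on the right, so its
  end is the start composed with \<open>act ls\<close>.\<close>

definition act :: "nat list \<Rightarrow> int \<Rightarrow> int"
  where "act ls = foldr (\<lambda>i f. prefix_reversal i \<circ> f) ls id"

lemma act_simps [simp]: "act [] x = x" "act (i # ls) x = prefix_reversal i (act ls x)"
  by (simp_all add: act_def)

lemma act_append [simp]: "act (xs @ ys) x = act xs (act ys x)"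
  by (induction xs) auto

lemma prefix_reversal_involution [simp]: "prefix_reversal i (prefix_reversal i x) = x"
  by (auto simp: prefix_reversal_def)

lemma prefix_reversal_minus: "prefix_reversal i (- x) = - prefix_reversal i x"
  by (auto simp: prefix_reversal_def)

lemma prefix_reversal_eq_iff: "prefix_reversal i x = y \<longleftrightarrow> x = prefix_reversal i y"
  by (metis prefix_reversal_involution)

lemma act_minus: "act ls (- x) = - act ls x"
  by (induction ls) (auto simp: prefix_reversal_minus)

lemma act_fixes_above: "\<forall>i\<in>set ls. i < k \<Longrightarrow> act ls (int k) = int k"
  by (induction ls) (auto simp: prefix_reversal_def)

lemma act_rev: "act (rev ls) (act ls x) = x"
  by (induction ls) auto

text \<open>Conjugating the relation by \<open>act xs\<close> moves the cut; hence any occurrence of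
  the largest label may serve as the starting point.\<close>

lemma act_rotate:
  assumes "\<And>x. act (xs @ ys) x = x"
  shows "act (ys @ xs) x = x"
  using assms[of "act xs x"] by (metis act_append act_rev)

lemma prefix_reversal_top: "1 \<le> k \<Longrightarrow> prefix_reversal k (int k) = -1"
  by (auto simp: prefix_reversal_def)

lemma prefix_reversal_1: "1 \<le> k \<Longrightarrow> prefix_reversal k 1 = - int k"
  by (auto simp: prefix_reversal_def)

section \<open>Short words that fix 1\<close>

lemma act_fixes_1_length_1: "1 \<le> i \<Longrightarrow> act [i] 1 \<noteq> 1"
  by (auto simp: prefix_reversal_def)

lemma act_fixes_1_length_2: "1 \<le> i \<Longrightarrow> 1 \<le> j \<Longrightarrow> i \<noteq> j \<Longrightarrow> act [i, j] 1 \<noteq> 1"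
  by (auto simp: prefix_reversal_def)

text \<open>1 first becomes -z, and only -x is sent to 1 at the end, so the middle reversal takes -z
  to -x. For \<open>y >= z\<close> its value would be positive; hence -z is not moved.\<close>

lemma act_fixes_1_length_3:
  assumes "1 \<le> x" "1 \<le> y" "1 \<le> z" "x \<noteq> y" "y \<noteq> z" "act [x, y, z] 1 = 1"
  shows "x = z \<and> y < z"
  using assms by (auto simp: prefix_reversal_def split: if_splits)

section \<open>Equations obtained by following k through the word\<close>

text \<open>\<open>A\<close> fixes k, and the remaining reversal moves it to -1.\<close>

lemma one_occurrence:
  assumes "1 \<le> k" "\<forall>i\<in>set A. i < k" "\<And>x. act (k # A) x = x"
  shows False
  using assms(3)[of "int k"] assms(1,2) by (simp add: act_fixes_above prefix_reversal_top)

text \<open>k passes \<open>B\<close> unmoved and is flipped to -1; it must leave \<open>A\<close>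
  as -1 again, since only -1 is flipped back to k.\<close>

lemma two_occurrences_fix_1:
  assumes "1 \<le> k" "\<forall>i\<in>set B. i < k" "\<And>x. act (k # A @ k # B) x = x"
  shows "act A 1 = 1"
proof -
  have "act A (-1) = -1"
    using assms(3)[of "int k"] assms(1,2)
    by (simp add: act_fixes_above prefix_reversal_top prefix_reversal_eq_iff)
  then show ?thesis by (simp add: act_minus)
qed

lemma two_occurrences:
  assumes "1 \<le> k" "\<forall>i\<in>set A \<union> set B. i < k" "\<And>x. act (k # A @ k # B) x = x"
  shows "act A 1 = 1" "act B 1 = 1"
proof -
  show "act A 1 = 1"
    using two_occurrences_fix_1[of k B A] assms by auto
  show "act B 1 = 1"
    using two_occurrences_fix_1[of k A B] act_rotate[of "k # A" "k # B"] assms by auto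
qed

text \<open>The same trace of k: \<open>C\<close> fixes it, so \<open>B\<close>, the flip and
  \<open>A\<close> in succession bring -1 back to -1.\<close>

lemma three_occurrences_image_1:
  assumes "1 \<le> k" "\<forall>i\<in>set C. i < k" "\<And>x. act (k # A @ k # B @ k # C) x = x"
  shows "act A (prefix_reversal k (act B 1)) = 1"
proof -
  have "act A (prefix_reversal k (act B (-1))) = -1"
    using assms(3)[of "int k"] assms(1,2)
    by (simp add: act_fixes_above prefix_reversal_top prefix_reversal_eq_iff[of k])
  then show ?thesis by (simp add: act_minus prefix_reversal_minus)
qed

lemma three_occurrences:
  assumes "1 \<le> k" "\<forall>i\<in>set A \<union> set B \<union> set C. i < k" "\<And>x. act (k # A @ k # B @ k # C) x = x"
  shows "act A (prefix_reversal k (act B 1)) = 1"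
    "act B (prefix_reversal k (act C 1)) = 1"
    "act C (prefix_reversal k (act A 1)) = 1"
proof -
  show "act A (prefix_reversal k (act B 1)) = 1"
    using three_occurrences_image_1[of k C A B] assms by auto
  show "act B (prefix_reversal k (act C 1)) = 1"
    using three_occurrences_image_1[of k A B C] act_rotate[of "k # A" "k # B @ k # C"] assms by auto
  show "act C (prefix_reversal k (act A 1)) = 1"
    using three_occurrences_image_1[of k B C A] act_rotate[of "k # A @ k # B" "k # C"] assms by auto
qed

section \<open>Excluding three occurrences\<close>

text \<open>1 becomes -b and then k + 1 - b, which is at least 2; reversal a either makes this
  negative or leaves it alone.\<close>

lemma no_two_single_pieces:
  assumes "1 \<le> a" "a < k" "1 \<le> b" "b < k"
  shows "act [a] (prefix_reversal k (act [b] 1)) \<noteq> 1"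
  using assms by (auto simp: prefix_reversal_def)

lemma act_pair_1:
  assumes "1 \<le> b" "1 \<le> c"
  shows "act [b, c] 1 = (if c \<le> b then int b + 1 - int c else - int c)"
  using assms by (simp add: prefix_reversal_def)

text \<open>A contradiction of signs: the two equations involving \<open>[a]\<close> force
  \<open>c < b\<close> and \<open>d < e\<close>, and then equation 2 equates a negative with a
  positive number.\<close>

lemma no_single_double_double_pieces:
  assumes "1 \<le> a" "a < k" "1 \<le> b" "b < k" "1 \<le> c" "c < k" "1 \<le> d" "d < k" "1 \<le> e" "e < k"
    and "b \<noteq> c" "d \<noteq> e"
    and 1: "act [a] (prefix_reversal k (act [b, c] 1)) = 1"
    and 2: "act [b, c] (prefix_reversal k (act [d, e] 1)) = 1"
    and 3: "act [d, e] (prefix_reversal k (act [a] 1)) = 1"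
  shows False
proof -
  have k: "prefix_reversal k (- int x) = int k + 1 - int x" if "1 \<le> x" "x < k" for x
    using that by (simp add: prefix_reversal_def)
  have "act [b, c] 1 = prefix_reversal k (prefix_reversal a 1)"
    using 1 by (metis act_simps prefix_reversal_involution)
  then have "act [b, c] 1 > 0"
    using k[of a] assms(1,2) by (simp add: prefix_reversal_1 del: act_simps)
  then have "c < b" using assms(3-6,11) by (simp add: act_pair_1 del: act_simps split: if_splits)
  \<comment> \<open>Applying the inverse word \<open>[e, d]\<close> to equation 3 isolates its
    argument.\<close>
  have "act [e, d] 1 = prefix_reversal k (prefix_reversal a 1)"
    using act_rev[of "[d, e]" "prefix_reversal k (act [a] 1)"] unfolding 3 by simp
  then have "act [e, d] 1 > 0"
    using k[of a] assms(1,2) by (simp add: prefix_reversal_1 del: act_simps)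
  then have "d < e" using assms(7-10,12) by (simp add: act_pair_1 del: act_simps split: if_splits)
  have "act [c, b] 1 = prefix_reversal k (act [d, e] 1)"
    using act_rev[of "[b, c]" "prefix_reversal k (act [d, e] 1)"] unfolding 2 by simp
  then have "- int b = int k + 1 - int e"
    using \<open>c < b\<close> \<open>d < e\<close> k[of e] assms(3-10) by (simp add: act_pair_1 del: act_simps)
  then show False using assms(10) by simp
qed

section \<open>Relations with two and with four occurrences\<close>

text \<open>Conjugation by the longer reversal carries the prefix of length y to the block of length
  y ending at z. The block is mirrored and negated; \<open>2 * z - y + 1\<close> is the sum of its
  end points.\<close>

lemma act_conj_positive:
  assumes "1 \<le> y" "y < z" "1 \<le> x"
  shows "act [z, y, z] x = (if int z - int y < x \<and> x \<le> int z then x - (2 * int z - int y + 1) else x)"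
proof -
  consider "x > int z" | "x \<le> int z - int y" | "int z - int y < x" "x \<le> int z" by linarith
  then show ?thesis
    using assms by cases (simp_all add: prefix_reversal_def)
qed

text \<open>The relation equates \<open>[z, y, z]\<close> with \<open>[k, j, i, j, k]\<close>. Each
  flips a single block, the second one mirrored by k; the blocks are compared through the positive
  integers that become negative.\<close>

lemma two_occurrences_triple:
  assumes "1 \<le> i" "i < j" "j < k" "1 \<le> y" "y < z" "z < k"
    and id: "\<And>x. act [k, j, i, j, k, z, y, z] x = x"
  shows "y = i \<and> z = k - j + i"
proof -
  \<comment> \<open>The palindrome \<open>[z, y, z]\<close> is its own inverse.\<close>
  have flip: "act [z, y, z] x = prefix_reversal k (act [j, i, j] (prefix_reversal k x))" for x
    using id[of "act [z, y, z] x"] by simp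
  have neg: "int z - int y < x \<and> x \<le> int z \<longleftrightarrow> int k - int j < x \<and> x \<le> int k - int j + int i"
    if x: "1 \<le> x" "x \<le> int k" for x
  proof -
    have "prefix_reversal k x = - (int k + 1 - x)"
      using x by (simp add: prefix_reversal_def)
    then have *: "act [z, y, z] x = - prefix_reversal k (act [j, i, j] (int k + 1 - x))"
      by (simp only: flip act_minus prefix_reversal_minus)
    have "act [z, y, z] x < 0 \<longleftrightarrow> int z - int y < x \<and> x \<le> int z"
      using assms(4,5) x by (subst act_conj_positive) auto
    moreover have "- prefix_reversal k (act [j, i, j] (int k + 1 - x)) < 0 \<longleftrightarrow>
        int k - int j < x \<and> x \<le> int k - int j + int i"
    proof (cases "int k - int j < x \<and> x \<le> int k - int j + int i")
      case True
      then have "act [j, i, j] (int k + 1 - x) = int k - x - 2 * int j + int i"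
        using assms(1-3) x by (subst act_conj_positive) auto
      then show ?thesis using True assms(1-3) by (simp add: prefix_reversal_def del: act_simps)
    next
      case False
      then have "act [j, i, j] (int k + 1 - x) = int k + 1 - x"
        using assms(1-3) x by (subst act_conj_positive) auto
      then show ?thesis using False x by (auto simp: prefix_reversal_def simp del: act_simps)
    qed
    ultimately show ?thesis using * by simp
  qed
  \<comment> \<open>Testing the end points of each block for membership in the other makes the
    blocks coincide.\<close>
  have "int z = int k - int j + int i"
    using neg[of "int z"] neg[of "int k - int j + int i"] assms(1-6) by linarith
  moreover have "int z - int y = int k - int j"
    using neg[of "int z - int y + 1"] neg[of "int k - int j + 1"] assms(1-6) by linarith
  ultimately show ?thesis using assms(3) by linarith
qed

text \<open>Inverting the second half gives an equality of two products, evaluated at 1 and k, the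
  ends of the stack. At either end, overlapping blocks would produce the wrong sign.\<close>

lemma four_occurrences:
  assumes "1 \<le> a" "a < k" "1 \<le> b" "b < k" "1 \<le> c" "c < k" "1 \<le> d" "d < k"
    and id: "\<And>x. act [k, a, k, b, k, c, k, d] x = x"
  shows "c = a \<and> d = b \<and> a + b \<le> k"
proof -
  have comm: "act [k, a, k, b] x = act [d, k, c, k] x" for x
  proof -
    have "x = act [k, a, k, b] (act [k, c, k, d] x)" for x
      using id[of x] by simp
    from this[of "act [d, k, c, k] x"] show ?thesis by simp
  qed
  have L: "act [k, a, k, b] 1 = (if a + b \<le> k then - int b else 2 * int k - int a - int b + 1)"
    "act [k, a, k, b] k = int a - int k - 1"
    using assms(1-4) by (auto simp: prefix_reversal_def)
  have R: "act [d, k, c, k] 1 = - int d"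
    "act [d, k, c, k] k = (if c + d \<le> k then int c - int k - 1 else int c + int d - int k)"
    using assms(5-8) by (auto simp: prefix_reversal_def)
  show ?thesis
    using comm[of 1] comm[of k] L R assms(1-8) by (auto simp del: act_simps split: if_splits)
qed

section \<open>Case analysis for relations of length eight\<close>

lemma relation_length_8:
  assumes "set [a, b, c, d, e, f, g] \<subseteq> {1..k}"
    and "k \<noteq> a" "a \<noteq> b" "b \<noteq> c" "c \<noteq> d" "d \<noteq> e" "e \<noteq> f" "f \<noteq> g" "g \<noteq> k"
    and id: "\<And>x. act [k, a, b, c, d, e, f, g] x = x"
  shows "(c = a \<and> d = k \<and> b < a \<and> a < k \<and> e = k - a + b \<and> f = b \<and> g = k - a + b) \<or>
    (b = k \<and> d = k \<and> f = k \<and> e = a \<and> g = c \<and> a + c \<le> k)"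
proof -
  have pos: "1 \<le> a" "1 \<le> b" "1 \<le> c" "1 \<le> d" "1 \<le> e" "1 \<le> f" "1 \<le> g" "1 \<le> k"
    and le: "a \<le> k" "b \<le> k" "c \<le> k" "d \<le> k" "e \<le> k" "f \<le> k" "g \<le> k"
    using assms(1) by auto
  have "a < k" "g < k"
    using le assms(2,9) by auto
  note ne = assms(2-9)
  note facts = pos \<open>a < k\<close> \<open>g < k\<close>
  have nonadjacent: "\<not> (b = k \<and> c = k)" "\<not> (c = k \<and> d = k)" "\<not> (d = k \<and> e = k)" "\<not> (e = k \<and> f = k)"
    using ne by blast+
  have lt: "b = k \<or> b < k" "c = k \<or> c < k" "d = k \<or> d < k" "e = k \<or> e < k" "f = k \<or> f < k"
    using le by (simp_all add: le_less disj_commute)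
  \<comment> \<open>Neither \<open>a\<close> nor \<open>g\<close> equals k, so the further
    occurrences form a set without neighbours among the five positions \<open>b\<close> to
    \<open>f\<close>: thirteen possibilities.\<close>
  consider
      "b < k" "c < k" "d < k" "e < k" "f < k"
    | "b = k" "c < k" "d < k" "e < k" "f < k"
    | "b < k" "c = k" "d < k" "e < k" "f < k"
    | (triple) "b < k" "c < k" "d = k" "e < k" "f < k"
    | "b < k" "c < k" "d < k" "e = k" "f < k"
    | "b < k" "c < k" "d < k" "e < k" "f = k"
    | "b = k" "c < k" "d = k" "e < k" "f < k"
    | "b = k" "c < k" "d < k" "e = k" "f < k"
    | "b = k" "c < k" "d < k" "e < k" "f = k"
    | "b < k" "c = k" "d < k" "e = k" "f < k"
    | "b < k" "c = k" "d < k" "e < k" "f = k"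
    | "b < k" "c < k" "d = k" "e < k" "f = k"
    | (four) "b = k" "c < k" "d = k" "e < k" "f = k"
    using nonadjacent lt by argo
  then show ?thesis
  proof cases
    case 1
    have *: "act (k # [a, b, c, d, e, f, g]) x = x" for x
      using id[of x] 1 by simp
    show ?thesis
      using one_occurrence[OF pos(8) _ *] 1 facts by simp
  next
    \<comment> \<open>Two pieces, both fixing 1. In every split except 3 + 3 one piece has at most
      two labels, which cannot fix 1.\<close>
    case 2
    have *: "act (k # [a] @ k # [c, d, e, f, g]) x = x" for x
      using id[of x] 2 by simp
    have "act [a] 1 = 1"
      by (rule two_occurrences(1)[OF pos(8) _ *]) (use 2 facts in simp)
    then show ?thesis
      using act_fixes_1_length_1[of a] facts by (simp del: act_simps)
  next
    case 3
    have *: "act (k # [a, b] @ k # [d, e, f, g]) x = x" for x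
      using id[of x] 3 by simp
    have "act [a, b] 1 = 1"
      by (rule two_occurrences(1)[OF pos(8) _ *]) (use 3 facts in simp)
    then show ?thesis
      using act_fixes_1_length_2[of a b] facts ne by (simp del: act_simps)
  next
    \<comment> \<open>The split 3 + 3: both pieces are palindromes with a smaller middle
      label.\<close>
    case triple
    have *: "act (k # [a, b, c] @ k # [e, f, g]) x = x" for x
      using id[of x] triple by simp
    have "act [a, b, c] 1 = 1"
      by (rule two_occurrences(1)[OF pos(8) _ *]) (use triple facts in simp)
    then have 1: "a = c \<and> b < c"
      using act_fixes_1_length_3[of a b c] facts ne by (simp del: act_simps)
    have "act [e, f, g] 1 = 1"
      by (rule two_occurrences(2)[OF pos(8) _ *]) (use triple facts in simp)
    then have 2: "e = g \<and> f < g"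
      using act_fixes_1_length_3[of e f g] facts ne by (simp del: act_simps)
    have "f = b \<and> g = k - a + b"
      by (rule two_occurrences_triple) (use 1 2 triple facts * in simp_all)
    then show ?thesis using 1 2 triple facts by simp
  next
    case 5
    have *: "act (k # [a, b, c, d] @ k # [f, g]) x = x" for x
      using id[of x] 5 by simp
    have "act [f, g] 1 = 1"
      by (rule two_occurrences(2)[OF pos(8) _ *]) (use 5 facts in simp)
    then show ?thesis
      using act_fixes_1_length_2[of f g] facts ne by (simp del: act_simps)
  next
    case 6
    have *: "act (k # [a, b, c, d, e] @ k # [g]) x = x" for x
      using id[of x] 6 by simp
    have "act [g] 1 = 1"
      by (rule two_occurrences(2)[OF pos(8) _ *]) (use 6 facts in simp)
    then show ?thesis
      using act_fixes_1_length_1[of g] facts by (simp del: act_simps)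
  next
    \<comment> \<open>Piece lengths 1, 1, 3: two cyclically neighbouring single labels, as also in
      the orders 1, 3, 1 and 3, 1, 1.\<close>
    case 7
    have *: "act (k # [a] @ k # [c] @ k # [e, f, g]) x = x" for x
      using id[of x] 7 by simp
    have "act [a] (prefix_reversal k (act [c] 1)) = 1"
      by (rule three_occurrences(1)[OF pos(8) _ *]) (use 7 facts in simp)
    then show ?thesis
      using no_two_single_pieces[of a k c] 7 facts by (simp del: act_simps)
  next
    \<comment> \<open>Piece lengths 1, 2, 2. For the cyclic shifts 2, 1, 2 and 2, 2, 1 the three
      equations are permuted so that the single label comes first.\<close>
    case 8
    have *: "act (k # [a] @ k # [c, d] @ k # [f, g]) x = x" for x
      using id[of x] 8 by simp
    have r1: "act [a] (prefix_reversal k (act [c, d] 1)) = 1"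
      by (rule three_occurrences(1)[OF pos(8) _ *]) (use 8 facts in simp)
    have r2: "act [c, d] (prefix_reversal k (act [f, g] 1)) = 1"
      by (rule three_occurrences(2)[OF pos(8) _ *]) (use 8 facts in simp)
    have r3: "act [f, g] (prefix_reversal k (act [a] 1)) = 1"
      by (rule three_occurrences(3)[OF pos(8) _ *]) (use 8 facts in simp)
    show ?thesis
      using no_single_double_double_pieces[OF _ _ _ _ _ _ _ _ _ _ _ _ r1 r2 r3] 8 facts ne by simp
  next
    case 9
    have *: "act (k # [a] @ k # [c, d, e] @ k # [g]) x = x" for x
      using id[of x] 9 by simp
    have "act [g] (prefix_reversal k (act [a] 1)) = 1"
      by (rule three_occurrences(3)[OF pos(8) _ *]) (use 9 facts in simp)
    then show ?thesis
      using no_two_single_pieces[of g k a] 9 facts by (simp del: act_simps)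
  next
    case 10
    have *: "act (k # [a, b] @ k # [d] @ k # [f, g]) x = x" for x
      using id[of x] 10 by simp
    have r1: "act [a, b] (prefix_reversal k (act [d] 1)) = 1"
      by (rule three_occurrences(1)[OF pos(8) _ *]) (use 10 facts in simp)
    have r2: "act [d] (prefix_reversal k (act [f, g] 1)) = 1"
      by (rule three_occurrences(2)[OF pos(8) _ *]) (use 10 facts in simp)
    have r3: "act [f, g] (prefix_reversal k (act [a, b] 1)) = 1"
      by (rule three_occurrences(3)[OF pos(8) _ *]) (use 10 facts in simp)
    show ?thesis
      using no_single_double_double_pieces[OF _ _ _ _ _ _ _ _ _ _ _ _ r2 r3 r1] 10 facts ne by simp
  next
    case 11
    have *: "act (k # [a, b] @ k # [d, e] @ k # [g]) x = x" for x
      using id[of x] 11 by simp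
    have r1: "act [a, b] (prefix_reversal k (act [d, e] 1)) = 1"
      by (rule three_occurrences(1)[OF pos(8) _ *]) (use 11 facts in simp)
    have r2: "act [d, e] (prefix_reversal k (act [g] 1)) = 1"
      by (rule three_occurrences(2)[OF pos(8) _ *]) (use 11 facts in simp)
    have r3: "act [g] (prefix_reversal k (act [a, b] 1)) = 1"
      by (rule three_occurrences(3)[OF pos(8) _ *]) (use 11 facts in simp)
    show ?thesis
      using no_single_double_double_pieces[OF _ _ _ _ _ _ _ _ _ _ _ _ r3 r1 r2] 11 facts ne by simp
  next
    case 12
    have *: "act (k # [a, b, c] @ k # [e] @ k # [g]) x = x" for x
      using id[of x] 12 by simp
    have "act [e] (prefix_reversal k (act [g] 1)) = 1"
      by (rule three_occurrences(2)[OF pos(8) _ *]) (use 12 facts in simp)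
    then show ?thesis
      using no_two_single_pieces[of e k g] 12 facts by (simp del: act_simps)
  next
    case four
    have "act [k, a, k, c, k, e, k, g] x = x" for x
      using id[of x] four by simp
    then have "e = a \<and> g = c \<and> a + c \<le> k"
      \<comment> \<open>The rotation makes the relation the first premise, where the chained fact is
        used.\<close>
      by (rule four_occurrences[rotated 8]) (use four facts in simp_all)
    then show ?thesis using four by simp
  qed
qed

section \<open>Label sequences and canonical forms\<close>

lemma label_sequence_rotate:
  assumes "label_sequence n us ls"
  shows "label_sequence n (rotate s us) (rotate s ls)"
  unfolding label_sequence_def
proof (intro conjI allI impI)
  show "length (rotate s ls) = length (rotate s us)"
    using assms by (simp add: label_sequence_def)
next
  fix t assume t: "t < length (rotate s us)"
  let ?m = "length us" and ?t = "(s + t) mod length us"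
  have *: "?t < ?m" "length ls = ?m" using t assms by (auto simp: label_sequence_def intro!: mod_less_divisor)
  have "rotate s ls ! t = ls ! ?t" "rotate s us ! t = us ! ?t"
    using t * by (auto simp: nth_rotate)
  moreover have "rotate s us ! (Suc t mod length (rotate s us)) = us ! (Suc ?t mod ?m)"
    using t by (subst nth_rotate) (auto simp: mod_simps intro!: mod_less_divisor)
  ultimately show "1 \<le> rotate s ls ! t" "rotate s ls ! t \<le> n"
    "rotate s us ! (Suc t mod length (rotate s us)) = rotate s us ! t \<circ> prefix_reversal (rotate s ls ! t)"
    using assms * by (auto simp: label_sequence_def)
qed

lemma traversals_rotate: "us \<in> traversals vs \<Longrightarrow> rotate s us \<in> traversals vs"
  by (auto simp: traversals_def rotate_rotate)

text \<open>Finiteness is what lets \<open>Max\<close> be attained and bound its set.\<close>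

lemma finite_label_sequences: "finite {ls. \<exists>us\<in>traversals vs. label_sequence n us ls}"
proof (rule finite_subset)
  show "{ls. \<exists>us\<in>traversals vs. label_sequence n us ls} \<subseteq> {ls. set ls \<subseteq> {..n} \<and> length ls = length vs}"
    by (fastforce simp: label_sequence_def traversals_def in_set_conv_nth)
  show "finite {ls. set ls \<subseteq> {..n} \<and> length ls = length vs}"
    by (rule finite_lists_length_eq) simp
qed

lemma burnt_pancake_cycle_label_sequence:
  assumes "burnt_pancake_cycle n vs"
  obtains ls where "label_sequence n vs ls"
proof -
  have "\<exists>i. 1 \<le> i \<and> i \<le> n \<and> vs ! (Suc t mod length vs) = vs ! t \<circ> prefix_reversal i"
    if "t < length vs" for t
  proof -
    have "{vs ! t, vs ! (Suc t mod length vs)} \<in> burnt_pancake_edges n"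
      using assms that unfolding burnt_pancake_cycle_def by blast
    then obtain w i where "{vs ! t, vs ! (Suc t mod length vs)} = {w, w \<circ> prefix_reversal i}" "1 \<le> i" "i \<le> n"
      unfolding burnt_pancake_edges_def by blast
    \<comment> \<open>The edge is unordered and may be traversed towards \<open>w\<close>; by the
      involution the label is the same in both directions.\<close>
    moreover have "w = w \<circ> prefix_reversal i \<circ> prefix_reversal i"
      by (auto simp: fun_eq_iff)
    ultimately show ?thesis by (metis doubleton_eq_iff)
  qed
  then obtain l where "\<And>t. t < length vs \<Longrightarrow>
      1 \<le> l t \<and> l t \<le> n \<and> vs ! (Suc t mod length vs) = vs ! t \<circ> prefix_reversal (l t)"
    by metis
  then have "label_sequence n vs (map l [0..<length vs])"
    by (auto simp: label_sequence_def)
  then show ?thesis by (rule that)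
qed

lemma canonical_form_label_sequence:
  assumes "burnt_pancake_cycle n vs"
  obtains us where "us \<in> traversals vs" "label_sequence n us (canonical_form n vs)"
proof -
  obtain ls where "label_sequence n vs ls"
    using assms by (rule burnt_pancake_cycle_label_sequence)
  moreover have "vs \<in> traversals vs"
    by (auto simp: traversals_def intro: exI[of _ 0])
  ultimately have "{ls. \<exists>us\<in>traversals vs. label_sequence n us ls} \<noteq> {}" by auto
  from Max_in[OF finite_label_sequences this] show ?thesis
    using that by (auto simp: canonical_form_def)
qed

text \<open>Rotating the labels amounts to another starting vertex, so every rotation competes in
  the maximum.\<close>

lemma canonical_form_rotate_le:
  assumes "burnt_pancake_cycle n vs"
  shows "rotate s (canonical_form n vs) \<le> canonical_form n vs"
proof -
  obtain us where "us \<in> traversals vs" "label_sequence n us (canonical_form n vs)"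
    using assms by (rule canonical_form_label_sequence)
  then have "rotate s (canonical_form n vs) \<in> {ls. \<exists>us\<in>traversals vs. label_sequence n us ls}"
    using traversals_rotate label_sequence_rotate by blast
  then show ?thesis
    unfolding canonical_form_def using Max_ge[OF finite_label_sequences] by blast
qed

lemma hd_mono: "xs \<noteq> [] \<Longrightarrow> ys \<noteq> [] \<Longrightarrow> xs \<le> ys \<Longrightarrow> hd xs \<le> hd ys"
  for xs ys :: "'a::linorder list"
  by (cases xs; cases ys) auto

section \<open>From cycles to relations\<close>

text \<open>Equal consecutive labels cancel and lead back to the vertex visited two steps
  before.\<close>

lemma label_sequence_distinct_adjacent:
  assumes ls: "label_sequence n us ls" and "distinct us" "3 \<le> length us" "t < length us"
  shows "ls ! t \<noteq> ls ! (Suc t mod length us)"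
proof
  let ?m = "length us"
  assume eq: "ls ! t = ls ! (Suc t mod ?m)"
  have "Suc t mod ?m < ?m" using assms(4) by (intro mod_less_divisor) linarith
  then have "us ! (Suc (Suc t mod ?m) mod ?m) = us ! (Suc t mod ?m) \<circ> prefix_reversal (ls ! (Suc t mod ?m))"
    "us ! (Suc t mod ?m) = us ! t \<circ> prefix_reversal (ls ! t)"
    using ls assms(4) unfolding label_sequence_def by blast+
  then have "us ! (Suc (Suc t mod ?m) mod ?m) = us ! t"
    by (simp add: eq fun_eq_iff)
  then have "Suc (Suc t mod ?m) mod ?m = t"
    using assms by (subst (asm) nth_eq_iff_index_eq) (auto intro!: mod_less_divisor)
  then show False
    using assms(3,4) by (auto simp: mod_Suc split: if_splits)
qed

lemma label_sequence_vertex: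
  assumes "label_sequence n us ls" "t < length us"
  shows "us ! t = us ! 0 \<circ> act (take t ls)"
  using assms(2)
proof (induction t)
  case 0
  then show ?case by (auto simp: fun_eq_iff)
next
  case (Suc t)
  then have "us ! Suc t = us ! t \<circ> prefix_reversal (ls ! t)"
    using assms(1) unfolding label_sequence_def by (metis Suc_lessD mod_less)
  moreover have "take (Suc t) ls = take t ls @ [ls ! t]"
    using Suc.prems assms(1) by (simp add: label_sequence_def take_Suc_conv_app_nth)
  ultimately show ?case using Suc by (auto simp: fun_eq_iff)
qed

text \<open>Going once round returns to the start, whose injectivity allows it to be cancelled on
  the left.\<close>

lemma label_sequence_act:
  assumes ls: "label_sequence n us ls" and "us \<noteq> []" "us ! 0 \<in> signed_perms n"
  shows "act ls x = x"
proof -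
  define t where "t = length us - 1"
  have t: "length us = Suc t" using assms(2) by (simp add: t_def)
  \<comment> \<open>The closing edge: \<open>Suc t mod length us\<close> is 0.\<close>
  then have "us ! 0 = us ! t \<circ> prefix_reversal (ls ! t)" "length ls = Suc t"
    using ls unfolding label_sequence_def by (auto dest!: spec[of _ t])
  moreover have "ls = take t ls @ [ls ! t]"
    using \<open>length ls = Suc t\<close> by (metis lessI order_refl take_Suc_conv_app_nth take_all)
  ultimately have "us ! 0 = us ! 0 \<circ> act ls"
    using label_sequence_vertex[OF ls, of t] t by (metis act_append act_simps comp_apply ext lessI)
  moreover have "inj (us ! 0)"
    using assms(3) by (auto simp: signed_perms_def dest: permutes_inj)
  ultimately show ?thesis by (metis comp_apply injD)
qed

section \<open>Reading off the four families\<close>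

theorem theorem4p1:
  fixes n :: nat and vs :: "(int \<Rightarrow> int) list"
  assumes "2 \<le> n"
    and "burnt_pancake_cycle n vs"
    and "length vs = 8"
  shows
    "(\<exists>i j k :: nat. 1 \<le> i \<and> i < j \<and> j \<le> k - 1 \<and> 3 \<le> k \<and> k \<le> n \<and>
        canonical_form n vs = [k, j, i, j, k, k - j + i, i, k - j + i]) \<or>
     (\<exists>i j k :: nat. 2 \<le> i \<and> i \<le> k - 2 \<and> 2 \<le> j \<and> j \<le> k - 2 \<and> i + j \<le> k \<and> 4 \<le> k \<and> k \<le> n \<and>
        canonical_form n vs = [k, j, k, i, k, j, k, i]) \<or>
     (\<exists>i k :: nat. 2 \<le> i \<and> i \<le> k - 1 \<and> 3 \<le> k \<and> k \<le> n \<and>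
        canonical_form n vs = [k, i, k, 1, k, i, k, 1]) \<or>
     (\<exists>k :: nat. 2 \<le> k \<and> k \<le> n \<and>
        canonical_form n vs = [k, 1, k, 1, k, 1, k, 1])"
proof -
  define ls where "ls = canonical_form n vs"
  obtain us where us: "us \<in> traversals vs" and lab: "label_sequence n us ls"
    using canonical_form_label_sequence[OF assms(2)] unfolding ls_def by metis
  have us_props: "length us = 8" "distinct us" "set us \<subseteq> signed_perms n"
    using us assms(2,3)
    by (auto simp: traversals_def burnt_pancake_cycle_def burnt_pancake_verts_def)
  have rot: "rotate s ls \<le> ls" for s
    unfolding ls_def by (rule canonical_form_rotate_le[OF assms(2)])
  have len: "length ls = 8" using lab us_props by (simp add: label_sequence_def)
  have range: "1 \<le> ls ! t \<and> ls ! t \<le> n" if "t < 8" for t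
    using lab us_props that by (auto simp: label_sequence_def)
  \<comment> \<open>Rotation by \<open>t\<close> begins with the label at index \<open>t\<close>, so
    maximality puts the largest label first.\<close>
  have le_hd: "ls ! t \<le> ls ! 0" if "t < 8" for t
  proof -
    have "ls \<noteq> []" using len by auto
    then have "hd (rotate t ls) \<le> hd ls" using hd_mono[OF _ _ rot[of t]] by simp
    with \<open>ls \<noteq> []\<close> show ?thesis
      using len that by (metis hd_conv_nth hd_rotate_conv_nth mod_less)
  qed
  have adj: "ls ! t \<noteq> ls ! (Suc t mod 8)" if "t < 8" for t
    using label_sequence_distinct_adjacent[OF lab, of t] us_props that by simp
  have "us \<noteq> []" "us ! 0 \<in> signed_perms n" using us_props by auto
  then have id: "act ls x = x" for x
    by (rule label_sequence_act[OF lab])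
  obtain k a b c d e f g where ls: "ls = [k, a, b, c, d, e, f, g]"
    using len by (auto simp: length_Suc_conv numeral_eq_Suc)
  have ne: "k \<noteq> a" "a \<noteq> b" "b \<noteq> c" "c \<noteq> d" "d \<noteq> e" "e \<noteq> f" "f \<noteq> g" "g \<noteq> k"
    using adj[of 0] adj[of 1] adj[of 2] adj[of 3] adj[of 4] adj[of 5] adj[of 6] adj[of 7]
    by (simp_all add: ls)
  have max: "set [a, b, c, d, e, f, g] \<subseteq> {1..k}" and "k \<le> n"
    using range[of 0] range[of 1] range[of 2] range[of 3] range[of 4] range[of 5] range[of 6] range[of 7]
      le_hd[of 1] le_hd[of 2] le_hd[of 3] le_hd[of 4] le_hd[of 5] le_hd[of 6] le_hd[of 7]
    by (simp_all add: ls)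
  have "(c = a \<and> d = k \<and> b < a \<and> a < k \<and> e = k - a + b \<and> f = b \<and> g = k - a + b) \<or>
    (b = k \<and> d = k \<and> f = k \<and> e = a \<and> g = c \<and> a + c \<le> k)"
    using relation_length_8[OF max] ne id unfolding ls by blast
  then show ?thesis
  proof (elim disjE conjE)
    assume "c = a" "d = k" "b < a" "a < k" "e = k - a + b" "f = b" "g = k - a + b"
    then have "1 \<le> b \<and> b < a \<and> a \<le> k - 1 \<and> 3 \<le> k \<and> k \<le> n \<and>
        canonical_form n vs = [k, a, b, a, k, k - a + b, b, k - a + b]"
      using max \<open>k \<le> n\<close> ls unfolding ls_def by auto
    then show ?thesis by blast
  next
    assume form: "b = k" "d = k" "f = k" "e = a" "g = c" "a + c \<le> k"
    then have can: "canonical_form n vs = [k, a, k, c, k, a, k, c]"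
      using ls unfolding ls_def by simp
    \<comment> \<open>Shifting by two swaps \<open>a\<close> and \<open>c\<close>, so maximality
      orders them; what remains is whether none, one or both of them are 1.\<close>
    have "c \<le> a" using rot[of 2] by (auto simp: ls form numeral_eq_Suc)
    then consider "2 \<le> c" "2 \<le> a" | "c = 1" "2 \<le> a" | "c = 1" "a = 1"
      using max by force
    then show ?thesis
    proof cases
      case 1
      \<comment> \<open>The bounds \<open>k - 2\<close> and \<open>4 <= k\<close> come from
        \<open>a + c <= k\<close>, as both summands are at least 2.\<close>
      then have "2 \<le> c \<and> c \<le> k - 2 \<and> 2 \<le> a \<and> a \<le> k - 2 \<and> c + a \<le> k \<and> 4 \<le> k \<and> k \<le> n \<and>
          canonical_form n vs = [k, a, k, c, k, a, k, c]"
        using can form \<open>k \<le> n\<close> by auto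
      then show ?thesis by blast
    next
      case 2
      then have "2 \<le> a \<and> a \<le> k - 1 \<and> 3 \<le> k \<and> k \<le> n \<and>
          canonical_form n vs = [k, a, k, 1, k, a, k, 1]"
        using can form \<open>k \<le> n\<close> by auto
      then show ?thesis by blast
    next
      case 3
      then have "2 \<le> k \<and> k \<le> n \<and> canonical_form n vs = [k, 1, k, 1, k, 1, k, 1]"
        using can form \<open>k \<le> n\<close> by auto
      then show ?thesis by blast
    qed
  qed
qed

end
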